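(* Let $R$ be a commutative ring with nonzero identity and $n\ge 1$ a natural number. Then $G=TD(R,n)$ is planar if and only if $G=TD(\mathbb{Z}_2,2)$, $G=TD(\mathbb{Z}_2,3)$ or $G=TD(\mathbb{Z}_3,2)$.
   Context: For a commutative ring $R$ with nonzero identity and an integer $n\ge1$, $TD(R,n)$ is the simple graph with vertex set $R^n\setminus\{(0,\ldots,0)\}$ in which two distinct vertices $\mathbf{x},\mathbf{y}$ are adjacent if and only if $\mathbf{x}\cdot\mathbf{y}=\sum_{i=1}^n x_iy_i=0$ in $R$. $\mathbb{Z}_k$ denotes the ring of integers modulo $k$. A graph is planar if it can be drawn in the plane so that its edges intersect only at their endpoints.
   Formalization: The formal theorem assumes n ≥ 2 instead of n ≥ 1, since the claim fails for n = 1: TD(Z_2,1) is a single vertex, hence planar, but is none of the three listed graphs; equality of graphs is read as isomorphism. *)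

theory Defs
  imports "HOL-Analysis.Analysis" "HOL-Number_Theory.Residues"
begin

record 'v sgraph =
  verts :: "'v set"
  edges :: "'v set set"

definition graph_iso :: "'v sgraph \<Rightarrow> 'w sgraph \<Rightarrow> bool" where
  "graph_iso G H \<longleftrightarrow>
     (\<exists>f. bij_betw f (verts G) (verts H) \<and>
          (\<forall>u\<in>verts G. \<forall>v\<in>verts G. {u, v} \<in> edges G \<longleftrightarrow> {f u, f v} \<in> edges H))"

text \<open>The plane is \<open>complex\<close>. The vertex \<open>v\<close> is drawn as the point \<open>p v\<close>, and the edge
  \<open>{u, v}\<close> as the arc (injective path) \<open>\<gamma> {u, v}\<close> joining \<open>p u\<close> and \<open>p v\<close>, in either
  direction.\<close>

definition planar_drawing ::
  "'v sgraph \<Rightarrow> ('v \<Rightarrow> complex) \<Rightarrow> ('v set \<Rightarrow> real \<Rightarrow> complex) \<Rightarrow> bool" where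
  "planar_drawing G p \<gamma> \<longleftrightarrow>
     inj_on p (verts G) \<and>
     (\<forall>e\<in>edges G. arc (\<gamma> e) \<and> {pathstart (\<gamma> e), pathfinish (\<gamma> e)} = p ` e) \<and>
     (\<forall>e\<in>edges G. \<forall>v\<in>verts G. p v \<in> path_image (\<gamma> e) \<longrightarrow> v \<in> e) \<and>
     (\<forall>e\<in>edges G. \<forall>e'\<in>edges G. e \<noteq> e' \<longrightarrow>
        path_image (\<gamma> e) \<inter> path_image (\<gamma> e') \<subseteq> p ` e \<inter> p ` e')"

definition planar :: "'v sgraph \<Rightarrow> bool" where
  "planar G \<longleftrightarrow> (\<exists>p \<gamma>. planar_drawing G p \<gamma>)"

definition dot :: "('a, 'b) ring_scheme \<Rightarrow> nat \<Rightarrow> (nat \<Rightarrow> 'a) \<Rightarrow> (nat \<Rightarrow> 'a) \<Rightarrow> 'a" where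
  "dot R n x y = (\<Oplus>\<^bsub>R\<^esub>i\<in>{1..n}. x i \<otimes>\<^bsub>R\<^esub> y i)"

text \<open>Elements of \<open>R\<^sup>n\<close> are functions on \<open>{1..n}\<close> with values in the carrier, equal to
  \<open>undefined\<close> elsewhere, so that each vector has exactly one representative.\<close>

definition TD :: "('a, 'b) ring_scheme \<Rightarrow> nat \<Rightarrow> (nat \<Rightarrow> 'a) sgraph" where
  "TD R n =
     (let V = ({1..n} \<rightarrow>\<^sub>E carrier R) - {\<lambda>i\<in>{1..n}. \<zero>\<^bsub>R\<^esub>}
      in \<lparr>verts = V,
          edges = {{x, y} | x y. x \<in> V \<and> y \<in> V \<and> x \<noteq> y \<and> dot R n x y = \<zero>\<^bsub>R\<^esub>}\<rparr>)"

lemma card_verts_residue: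
  assumes "m \<ge> 1"
  shows "card (verts (TD (residue_ring (int m)) n)) = m ^ n - 1"
proof -
  let ?R = "residue_ring (int m)"
  have "(\<lambda>i\<in>{1..n}. \<zero>\<^bsub>?R\<^esub>) \<in> {1..n} \<rightarrow>\<^sub>E carrier ?R"
    using assms by (auto simp: residue_ring_def)
  moreover have "card ({1..n} \<rightarrow>\<^sub>E carrier ?R) = m ^ n"
    using assms by (simp add: card_PiE residue_ring_def)
  moreover have "finite ({1..n} \<rightarrow>\<^sub>E carrier ?R)"
    by (intro finite_PiE) (auto simp: residue_ring_def)
  ultimately show ?thesis by (simp add: TD_def Let_def)
qed

text \<open>The dimension-one graph over \<open>\<int>\<^sub>2\<close> is a single vertex: it is planar but not isomorphic to
  any of the three graphs of the classification, which therefore has to start at \<open>n = 2\<close>.\<close>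

lemma dimension_one_counterexample:
  "planar (TD (residue_ring 2) 1)"
  "\<not> graph_iso (TD (residue_ring 2) 1) (TD (residue_ring 2) 2)"
  "\<not> graph_iso (TD (residue_ring 2) 1) (TD (residue_ring 2) 3)"
  "\<not> graph_iso (TD (residue_ring 2) 1) (TD (residue_ring 3) 2)"
proof -
  have c: "card (verts (TD (residue_ring 2) 1)) = 1" "card (verts (TD (residue_ring 2) 2)) = 3"
    "card (verts (TD (residue_ring 2) 3)) = 7" "card (verts (TD (residue_ring 3) 2)) = 8"
    using card_verts_residue[of 2] card_verts_residue[of 3] by simp_all
  show "\<not> graph_iso (TD (residue_ring 2) 1) (TD (residue_ring 2) 2)"
    "\<not> graph_iso (TD (residue_ring 2) 1) (TD (residue_ring 2) 3)"
    "\<not> graph_iso (TD (residue_ring 2) 1) (TD (residue_ring 3) 2)"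
    using c by (auto simp: graph_iso_def dest!: bij_betw_same_card)
  obtain a where a: "verts (TD (residue_ring 2) 1) = {a}"
    using c(1) card_1_singletonE by blast
  then have "edges (TD (residue_ring 2) 1) = {}"
    by (auto simp: TD_def Let_def)
  then have "planar_drawing (TD (residue_ring 2) 1) (\<lambda>_. 0) (\<lambda>_ _. 0)"
    using a by (simp add: planar_drawing_def)
  then show "planar (TD (residue_ring 2) 1)"
    unfolding planar_def by blast
qed

end

theory Submission imports Defs begin

text \<open>A drawing of \<open>K\<^sub>3\<^sub>,\<^sub>3\<close> would contain a theta curve, made of three arcs from one vertex \<open>a\<close> to
  another vertex \<open>b\<close> through the three vertices of the other side, together with a point \<open>z\<close> that
  is connected to each of the arcs without touching the other two. But one arc of a theta curve runs
  inside the closed curve formed by the other two (\<open>theta.some_arc_inside\<close>, from Janiszewski's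
  theorem), and it divides this inside into two regions, each bounded by only two of the arcs. A
  point connected to the middle arc without touching the outer two lies in one of these regions, and
  from there the third arc is out of reach (\<open>theta.no_common_point\<close>). Hence \<open>K\<^sub>3\<^sub>,\<^sub>3\<close> is not planar, even with
  one edge subdivided (\<open>subdivided_K33_not_planar\<close>).

  Vectors with disjoint supports are orthogonal in any ring, and this alone yields such subgraphs
  in almost all cases: in the plane if the ring has three nonzero elements, in dimension three if it
  has two, and in dimension four always. What remains are the rings with two elements, in dimensions
  two and three, and the rings with three elements, in dimension two. A ring with two or three
  elements is isomorphic to the integers modulo two or three, and an isomorphism of rings induces an
  isomorphism of the graphs (\<open>graph_iso_TD\<close>).

  Conversely, the three remaining graphs are small: an edge with an isolated vertex, a subdivision
  of \<open>K\<^sub>4\<close>, and two disjoint 4-cycles. They have straight-line drawings with integral vertices.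
  Such a drawing is correct if certain determinants are nonzero or have equal signs
  (\<open>straight_line_planar\<close>), which is verified by computation.\<close>

section \<open>Theta curves\<close>

lemma connected_meets_inside_subset:
  assumes "connected D" "D \<inter> S = {}" "D \<inter> inside S \<noteq> {}"
  shows "D \<subseteq> inside S"
proof
  fix y assume "y \<in> D"
  obtain x where x: "x \<in> D" "x \<in> inside S" using assms(3) by blast
  have "D \<subseteq> - S" using assms(2) by blast
  then have "connected_component (- S) x y"
    unfolding connected_component_def using assms(1) x(1) \<open>y \<in> D\<close> by blast
  then show "y \<in> inside S" using x(2) inside_same_component by blast
qed

text \<open>Three arcs with common endpoints and no other common points. The roles of the arcs are
  interchangeable; statements are made for one choice of roles and transported to the others by
  \<open>rotate\<close> and \<open>swap_arcs\<close>.\<close>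
locale theta =
  fixes P1 P2 P3 :: "real \<Rightarrow> complex" and a b :: complex
  assumes arcs: "arc P1" "arc P2" "arc P3"
    and starts: "pathstart P1 = a" "pathstart P2 = a" "pathstart P3 = a"
    and finishes: "pathfinish P1 = b" "pathfinish P2 = b" "pathfinish P3 = b"
    and meets: "path_image P1 \<inter> path_image P2 = {a, b}"
      "path_image P1 \<inter> path_image P3 = {a, b}"
      "path_image P2 \<inter> path_image P3 = {a, b}"
begin

lemma rotate: "theta P2 P3 P1 a b"
  by (rule theta.intro[OF arcs(2,3,1) starts(2,3,1) finishes(2,3,1) meets(3)])
    (use meets(1,2) in blast)+

lemma swap_arcs: "theta P2 P1 P3 a b"
  by (rule theta.intro[OF arcs(2,1,3) starts(2,1,3) finishes(2,1,3) _ meets(3,2)])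
    (use meets(1) in blast)

lemma ends_distinct: "a \<noteq> b"
  using arcs(1) starts(1) finishes(1) arc_distinct_ends by blast

lemma Jordan12:
  shows "inside (path_image P1 \<union> path_image P2) \<noteq> {}"
    and "connected (inside (path_image P1 \<union> path_image P2))"
    and "connected (outside (path_image P1 \<union> path_image P2))"
    and "frontier (inside (path_image P1 \<union> path_image P2)) = path_image P1 \<union> path_image P2"
proof -
  let ?c = "P1 +++ reversepath P2"
  have "simple_path ?c" "pathfinish ?c = pathstart ?c"
    using arcs starts finishes meets by (simp_all add: simple_path_join_loop_eq arc_reversepath)
  moreover have "path_image ?c = path_image P1 \<union> path_image P2"
    using starts finishes by (simp add: path_image_join)
  ultimately show
    "inside (path_image P1 \<union> path_image P2) \<noteq> {}"
    "connected (inside (path_image P1 \<union> path_image P2))"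
    "connected (outside (path_image P1 \<union> path_image P2))"
    "frontier (inside (path_image P1 \<union> path_image P2)) = path_image P1 \<union> path_image P2"
    using Jordan_inside_outside[of ?c] by auto
qed

lemma inner_point: obtains m where "m \<in> path_image P2" "m \<noteq> a" "m \<noteq> b"
proof -
  have "P2 (1/2) \<noteq> P2 0" "P2 (1/2) \<noteq> P2 1"
    using arcs(2) unfolding arc_def by (auto dest: inj_onD)
  then show thesis
    using that[of "P2 (1/2)"] starts(2) finishes(2)
    by (simp add: pathstart_def pathfinish_def path_image_def)
qed

text \<open>The inside of \<open>P1 \<union> P2\<close> is connected and misses \<open>P1 \<union> P3\<close>, so it lies entirely inside
  \<open>P1 \<union> P3\<close> as soon as it meets that region. Taking closures, its boundary arc \<open>P2\<close> is dragged
  along, except for the endpoints.\<close>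
lemma inside_absorbs_arc:
  assumes "path_image P3 \<inter> inside (path_image P1 \<union> path_image P2) = {}"
    and "inside (path_image P1 \<union> path_image P2) \<inter> inside (path_image P1 \<union> path_image P3) \<noteq> {}"
  shows "path_image P2 \<inter> inside (path_image P1 \<union> path_image P3) \<noteq> {}"
proof -
  interpret s: theta P3 P1 P2 a b by (rule theta.rotate[OF rotate])
  let ?A = "inside (path_image P1 \<union> path_image P2)"
  let ?B = "inside (path_image P1 \<union> path_image P3)"
  have "?A \<inter> (path_image P1 \<union> path_image P3) = {}"
    using assms(1) inside_no_overlap[of "path_image P1 \<union> path_image P2"] by blast
  then have "?A \<subseteq> ?B"
    by (intro connected_meets_inside_subset Jordan12(2) assms(2))
  then have mono: "closure ?A \<subseteq> closure ?B" by (rule closure_mono)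
  have P2: "path_image P2 \<subseteq> closure ?A"
    using Jordan12(4) by (auto simp: closure_Un_frontier)
  have clB: "closure ?B = ?B \<union> (path_image P1 \<union> path_image P3)"
    using s.Jordan12(4) by (simp add: closure_Un_frontier Un_commute)
  obtain m where m: "m \<in> path_image P2" "m \<noteq> a" "m \<noteq> b" by (rule inner_point)
  then have "m \<notin> path_image P1 \<union> path_image P3" using meets(1,3) by auto
  then have "m \<in> ?B" using m(1) P2 mono clB by auto
  then show ?thesis using m(1) by auto
qed

text \<open>Intuitively, one of the three arcs runs between the other two. If none did, a point \<open>q\<close>
  inside \<open>P1 \<union> P2\<close> would be outside \<open>P1 \<union> P3\<close> and outside \<open>P2 \<union> P3\<close>, by
  \<open>inside_absorbs_arc\<close>. So neither of these two closed curves separates \<open>q\<close> from infinity. They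
  meet in the connected set \<open>P3\<close>, so by Janiszewski's theorem their union does not separate \<open>q\<close>
  from infinity either, although it contains \<open>P1 \<union> P2\<close>.\<close>
lemma some_arc_inside:
  "path_image P1 \<inter> inside (path_image P2 \<union> path_image P3) \<noteq> {} \<or>
   path_image P2 \<inter> inside (path_image P1 \<union> path_image P3) \<noteq> {} \<or>
   path_image P3 \<inter> inside (path_image P1 \<union> path_image P2) \<noteq> {}"
proof (rule ccontr)
  assume "\<not> ?thesis"
  then have out: "path_image P1 \<inter> inside (path_image P2 \<union> path_image P3) = {}"
    "path_image P2 \<inter> inside (path_image P1 \<union> path_image P3) = {}"
    "path_image P3 \<inter> inside (path_image P1 \<union> path_image P2) = {}" by simp_all
  have r: "theta P2 P3 P1 a b" by (rule rotate)
  have s: "theta P2 P1 P3 a b" by (rule swap_arcs)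
  have t: "theta P3 P1 P2 a b" by (rule theta.rotate[OF r])
  have comp: "compact (path_image P1)" "compact (path_image P2)" "compact (path_image P3)"
    using arcs compact_arc_image by blast+
  obtain q where q: "q \<in> inside (path_image P1 \<union> path_image P2)" using Jordan12(1) by blast
  have q13: "q \<notin> inside (path_image P1 \<union> path_image P3)"
    using inside_absorbs_arc[OF out(3)] out(2) q by auto
  have q23: "q \<notin> inside (path_image P2 \<union> path_image P3)"
    using theta.inside_absorbs_arc[OF s] out(1,3) q by (metis Un_commute disjoint_iff)
  have qnot: "q \<notin> path_image P1 \<union> path_image P2 \<union> path_image P3"
    using q out(3) inside_no_overlap[of "path_image P1 \<union> path_image P2"] by blast
  obtain w where w: "w \<in> outside (path_image P1 \<union> path_image P2 \<union> path_image P3)"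
    using outside_bounded_nonempty[of "path_image P1 \<union> path_image P2 \<union> path_image P3"] comp
    by (auto simp: compact_imp_bounded)
  then have w': "w \<in> outside (path_image P1 \<union> path_image P3)"
    "w \<in> outside (path_image P2 \<union> path_image P3)" "w \<in> outside (path_image P1 \<union> path_image P2)"
    by (meson outside_mono subsetD Un_upper1 Un_upper2 Un_mono order_refl le_supI1 le_supI)+
  have out13: "q \<in> outside (path_image P1 \<union> path_image P3)"
    and out23: "q \<in> outside (path_image P2 \<union> path_image P3)"
    using q13 q23 qnot inside_Un_outside[of "path_image P1 \<union> path_image P3"] inside_Un_outside[of "path_image P2 \<union> path_image P3"] by blast+
  have "connected_component (- (path_image P1 \<union> path_image P3)) q w"
    using out13 w'(1) theta.Jordan12(3)[OF t] unfolding connected_component_def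
    by (metis Compl_anti_mono Un_commute outside_inside sup.cobounded1)
  moreover have "connected_component (- (path_image P2 \<union> path_image P3)) q w"
    using out23 w'(2) theta.Jordan12(3)[OF r] unfolding connected_component_def
    by (metis Compl_anti_mono outside_inside sup.cobounded1)
  moreover have "(path_image P1 \<union> path_image P3) \<inter> (path_image P2 \<union> path_image P3) = path_image P3"
    using meets by blast
  moreover have "connected (path_image P3)"
    using arcs(3) by (simp add: arc_imp_path connected_path_image)
  ultimately have "connected_component
      (- ((path_image P1 \<union> path_image P3) \<union> (path_image P2 \<union> path_image P3))) q w"
    using comp
    by (intro Janiszewski[where S = "path_image P1 \<union> path_image P3"])
      (simp_all only: compact_Un compact_imp_closed)
  then have "connected_component (- (path_image P1 \<union> path_image P2)) q w"
    by (rule connected_component_of_subset) blast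
  then have "w \<in> inside (path_image P1 \<union> path_image P2)"
    using q inside_same_component by blast
  then show False using w'(3) inside_Int_outside by blast
qed

text \<open>The arc \<open>P3\<close> cuts the inside of \<open>P1 \<union> P2\<close> into the insides of \<open>P1 \<union> P3\<close> and
  \<open>P2 \<union> P3\<close>. Since \<open>D3\<close> touches \<open>P3\<close>, it traps \<open>z\<close> in one of these two pieces. The set
  reaching for the arc that does not bound this piece cannot leave the piece.\<close>
lemma arc_inside_no_common_point:
  assumes "path_image P3 \<inter> inside (path_image P1 \<union> path_image P2) \<noteq> {}"
    and conn: "connected D1" "connected D2" "connected D3"
    and z: "z \<in> D1" "z \<in> D2" "z \<in> D3"
    and touch: "D1 \<inter> path_image P1 \<noteq> {}" "D2 \<inter> path_image P2 \<noteq> {}" "D3 \<inter> path_image P3 \<noteq> {}"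
    and avoid: "D1 \<inter> (path_image P2 \<union> path_image P3) = {}"
      "D2 \<inter> (path_image P1 \<union> path_image P3) = {}" "D3 \<inter> (path_image P1 \<union> path_image P2) = {}"
  shows False
proof -
  let ?I12 = "inside (path_image P1 \<union> path_image P2)"
  let ?I13 = "inside (path_image P1 \<union> path_image P3)"
  let ?I23 = "inside (path_image P2 \<union> path_image P3)"
  have split: "?I13 \<union> ?I23 \<union> (path_image P3 - {a, b}) = ?I12"
    by (rule split_inside_simple_closed_curve[of P1 a b P2 P3])
      (use arcs starts finishes meets ends_distinct assms(1) in \<open>auto simp: arc_imp_simple_path\<close>)
  have ab: "{a, b} \<subseteq> path_image P1" "{a, b} \<subseteq> path_image P2" using meets by auto
  have "D3 \<inter> ?I12 \<noteq> {}" using touch(3) avoid(3) ab split by blast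
  then have "z \<in> ?I12" using connected_meets_inside_subset[OF conn(3) avoid(3)] z by blast
  moreover have "z \<notin> path_image P3" using z avoid by blast
  ultimately consider "z \<in> ?I13" | "z \<in> ?I23" using split by blast
  then show False
  proof cases
    case 1
    then have "D2 \<subseteq> ?I13" using connected_meets_inside_subset[OF conn(2) avoid(2)] z by blast
    then show False using touch(2) split inside_no_overlap[of "path_image P1 \<union> path_image P2"] by blast
  next
    case 2
    then have "D1 \<subseteq> ?I23" using connected_meets_inside_subset[OF conn(1) avoid(1)] z by blast
    then show False using touch(1) split inside_no_overlap[of "path_image P1 \<union> path_image P2"] by blast
  qed
qed

text \<open>Whichever arc runs inside the other two, \<open>arc_inside_no_common_point\<close> applies with the
  roles of the arcs permuted. This is the topological content of the nonplanarity of
  \<open>K\<^sub>3\<^sub>,\<^sub>3\<close>; connected sets rather than arcs are allowed so that an edge may also be a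
  path of several edges.\<close>
lemma no_common_point:
  assumes conn: "connected D1" "connected D2" "connected D3"
    and z: "z \<in> D1" "z \<in> D2" "z \<in> D3"
    and touch: "D1 \<inter> path_image P1 \<noteq> {}" "D2 \<inter> path_image P2 \<noteq> {}" "D3 \<inter> path_image P3 \<noteq> {}"
    and avoid: "D1 \<inter> (path_image P2 \<union> path_image P3) = {}"
      "D2 \<inter> (path_image P1 \<union> path_image P3) = {}" "D3 \<inter> (path_image P1 \<union> path_image P2) = {}"
  shows False
proof -
  interpret r: theta P2 P3 P1 a b by (rule rotate)
  interpret s: theta P3 P1 P2 a b by (rule r.rotate)
  from some_arc_inside consider
      "path_image P3 \<inter> inside (path_image P1 \<union> path_image P2) \<noteq> {}"
    | "path_image P1 \<inter> inside (path_image P2 \<union> path_image P3) \<noteq> {}"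
    | "path_image P2 \<inter> inside (path_image P3 \<union> path_image P1) \<noteq> {}" by (auto simp: Un_commute)
  then show False
  proof cases
    case 1 then show False using arc_inside_no_common_point assms by blast
  next
    case 2
    show False by (rule r.arc_inside_no_common_point[OF 2 conn(2,3,1) z(2,3,1) touch(2,3,1)])
        (use avoid in blast)+
  next
    case 3
    show False by (rule s.arc_inside_no_common_point[OF 3 conn(3,1,2) z(3,1,2) touch(3,1,2)])
        (use avoid in blast)+
  qed
qed

end

section \<open>Drawings of graphs and the nonplanarity of \<open>K\<^sub>3\<^sub>,\<^sub>3\<close>\<close>

definition simple_edges :: "'v sgraph \<Rightarrow> bool" where
  "simple_edges G \<longleftrightarrow>
     (\<forall>e\<in>edges G. \<exists>u v. e = {u, v} \<and> u \<noteq> v \<and> u \<in> verts G \<and> v \<in> verts G)"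

lemma simple_edgesD: "simple_edges G \<Longrightarrow> e \<in> edges G \<Longrightarrow> e \<subseteq> verts G"
  unfolding simple_edges_def by fastforce

lemma simple_edgesE:
  assumes "simple_edges G" "e \<in> edges G"
  obtains u v where "e = {u, v}" "u \<noteq> v" "u \<in> verts G" "v \<in> verts G"
  using assms unfolding simple_edges_def by blast

lemma planar_drawingD:
  assumes "planar_drawing G p \<gamma>"
  shows "inj_on p (verts G)"
    and "e \<in> edges G \<Longrightarrow> arc (\<gamma> e)"
    and "e \<in> edges G \<Longrightarrow> {pathstart (\<gamma> e), pathfinish (\<gamma> e)} = p ` e"
    and "e \<in> edges G \<Longrightarrow> v \<in> verts G \<Longrightarrow> p v \<in> path_image (\<gamma> e) \<Longrightarrow> v \<in> e"
    and "e \<in> edges G \<Longrightarrow> e' \<in> edges G \<Longrightarrow> e \<noteq> e' \<Longrightarrow>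
      path_image (\<gamma> e) \<inter> path_image (\<gamma> e') \<subseteq> p ` e \<inter> p ` e'"
  using assms unfolding planar_drawing_def by (meson | metis)+

text \<open>A drawing does not fix the direction in which an edge is traversed; this lemma selects
  the direction that concatenation of arcs needs.\<close>
lemma drawing_edge_arc:
  assumes "planar_drawing G p \<gamma>" "{u, v} \<in> edges G"
  obtains g where "arc g" "pathstart g = p u" "pathfinish g = p v"
    "path_image g = path_image (\<gamma> {u, v})"
proof -
  let ?g = "\<gamma> {u, v}"
  have g: "arc ?g" "{pathstart ?g, pathfinish ?g} = {p u, p v}"
    using planar_drawingD(2,3)[OF assms] by simp_all
  then consider "pathstart ?g = p u" "pathfinish ?g = p v"
    | "pathstart ?g = p v" "pathfinish ?g = p u" by (auto simp: doubleton_eq_iff)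
  then show thesis
  proof cases
    case 1 then show thesis using that g(1) by blast
  next
    case 2
    then show thesis using that[of "reversepath ?g"] g(1) by (simp add: arc_reversepath)
  qed
qed

lemma drawing_endpoint:
  assumes "planar_drawing G p \<gamma>" "e \<in> edges G" "u \<in> e"
  shows "p u \<in> path_image (\<gamma> e)"
proof -
  have "p ` e = {pathstart (\<gamma> e), pathfinish (\<gamma> e)}"
    using planar_drawingD(3)[OF assms(1,2)] by simp
  then have "p u \<in> {pathstart (\<gamma> e), pathfinish (\<gamma> e)}" using assms(3) by auto
  then show ?thesis by auto
qed

lemma drawing_connected:
  assumes "planar_drawing G p \<gamma>" "e \<in> edges G"
  shows "connected (path_image (\<gamma> e))"
  using planar_drawingD(2)[OF assms] by (simp add: arc_imp_path connected_path_image)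

lemma drawing_edges_meet:
  assumes "planar_drawing G p \<gamma>" "simple_edges G" "e \<in> edges G" "e' \<in> edges G" "e \<noteq> e'"
  shows "path_image (\<gamma> e) \<inter> path_image (\<gamma> e') \<subseteq> p ` (e \<inter> e')"
proof -
  have "p ` (e \<inter> e') = p ` e \<inter> p ` e'"
    using planar_drawingD(1)[OF assms(1)] simple_edgesD[OF assms(2,3)] simple_edgesD[OF assms(2,4)]
    by (rule inj_on_image_Int)
  then show ?thesis using planar_drawingD(5)[OF assms(1,3-5)] by simp
qed

lemma drawing_disjoint_edges:
  assumes "planar_drawing G p \<gamma>" "simple_edges G" "e \<in> edges G" "e' \<in> edges G" "e \<inter> e' = {}"
  shows "path_image (\<gamma> e) \<inter> path_image (\<gamma> e') = {}"
proof -
  have "e \<noteq> e'" using assms(2,3,5) by (auto simp: simple_edges_def)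
  then show ?thesis using drawing_edges_meet[OF assms(1-4)] assms(5) by auto
qed

lemma drawing_path2:
  assumes "planar_drawing G p \<gamma>" "simple_edges G" "{a, c} \<in> edges G" "{c, b} \<in> edges G" "a \<noteq> b"
  obtains g where "arc g" "pathstart g = p a" "pathfinish g = p b"
    "path_image g = path_image (\<gamma> {a, c}) \<union> path_image (\<gamma> {c, b})"
proof -
  have ne: "a \<noteq> c" "b \<noteq> c"
    using simple_edgesE[OF assms(2,3)] simple_edgesE[OF assms(2,4)]
    by (metis doubleton_eq_iff)+
  obtain g where g: "arc g" "pathstart g = p a" "pathfinish g = p c"
    "path_image g = path_image (\<gamma> {a, c})" by (rule drawing_edge_arc[OF assms(1,3)])
  obtain h where h: "arc h" "pathstart h = p c" "pathfinish h = p b"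
    "path_image h = path_image (\<gamma> {c, b})" by (rule drawing_edge_arc[OF assms(1,4)])
  have "path_image g \<inter> path_image h \<subseteq> p ` ({a, c} \<inter> {c, b})"
    unfolding g(4) h(4) using assms ne by (intro drawing_edges_meet) (auto simp: doubleton_eq_iff)
  also have "\<dots> = {p c}" using assms(5) ne by auto
  finally have "arc (g +++ h)" using g h by (simp add: arc_join)
  then show thesis using that[of "g +++ h"] g h by (simp add: path_image_join)
qed

text \<open>The paths from \<open>a\<close> to \<open>b\<close> through \<open>c1, c2, c3\<close> are drawn as the three arcs of a theta
  curve, and the connections from \<open>z\<close> to these vertices violate \<open>no_common_point\<close>. One
  connection may have a further vertex in the middle, which \<open>two_nonzero_not_planar\<close> needs.\<close>
theorem subdivided_K33_not_planar:
  assumes simp: "simple_edges G"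
    and dist: "distinct [a, b, z, c1, c2, c3]"
    and a: "{a, c1} \<in> edges G" "{a, c2} \<in> edges G" "{a, c3} \<in> edges G"
    and b: "{b, c1} \<in> edges G" "{b, c2} \<in> edges G" "{b, c3} \<in> edges G"
    and z: "{z, c2} \<in> edges G" "{z, c3} \<in> edges G"
    and link: "{z, c1} \<in> edges G \<or>
      (\<exists>x. x \<notin> {a, b, c2, c3} \<and> {z, x} \<in> edges G \<and> {x, c1} \<in> edges G)"
  shows "\<not> planar G"
proof
  assume "planar G"
  then obtain p \<gamma> where dr: "planar_drawing G p \<gamma>" unfolding planar_def by blast
  define I where "I e = path_image (\<gamma> e)" for e
  have meet: "I e \<inter> I e' \<subseteq> p ` (e \<inter> e')" if "e \<in> edges G" "e' \<in> edges G" "e \<noteq> e'" for e e'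
    using drawing_edges_meet[OF dr simp that] by (simp add: I_def)
  have disj: "I e \<inter> I e' = {}" if "e \<in> edges G" "e' \<in> edges G" "e \<inter> e' = {}" for e e'
    using drawing_disjoint_edges[OF dr simp that] by (simp add: I_def)
  have endp: "p u \<in> I e" if "e \<in> edges G" "u \<in> e" for e u
    using drawing_endpoint[OF dr that] by (simp add: I_def)
  have con: "connected (I e)" if "e \<in> edges G" for e
    using drawing_connected[OF dr that] by (simp add: I_def)
  have b': "{c1, b} \<in> edges G" "{c2, b} \<in> edges G" "{c3, b} \<in> edges G"
    using b by (simp_all add: insert_commute)
  have ab: "a \<noteq> b" using dist by simp
  obtain P1 where P1: "arc P1" "pathstart P1 = p a" "pathfinish P1 = p b"
    "path_image P1 = I {a, c1} \<union> I {c1, b}"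
    using drawing_path2[OF dr simp a(1) b'(1) ab] unfolding I_def by blast
  obtain P2 where P2: "arc P2" "pathstart P2 = p a" "pathfinish P2 = p b"
    "path_image P2 = I {a, c2} \<union> I {c2, b}"
    using drawing_path2[OF dr simp a(2) b'(2) ab] unfolding I_def by blast
  obtain P3 where P3: "arc P3" "pathstart P3 = p a" "pathfinish P3 = p b"
    "path_image P3 = I {a, c3} \<union> I {c3, b}"
    using drawing_path2[OF dr simp a(3) b'(3) ab] unfolding I_def by blast
  have crossing: "(I {a, c} \<union> I {c, b}) \<inter> (I {a, d} \<union> I {d, b}) = {p a, p b}"
    if "{a, c} \<in> edges G" "{c, b} \<in> edges G" "{a, d} \<in> edges G" "{d, b} \<in> edges G"
      "distinct [a, b, c, d]" for c d
  proof -
    have "I {a, c} \<inter> I {a, d} \<subseteq> {p a}" "I {c, b} \<inter> I {d, b} \<subseteq> {p b}"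
      using meet[OF that(1,3)] meet[OF that(2,4)] that(5) by (auto simp: doubleton_eq_iff)
    moreover have "I {a, c} \<inter> I {d, b} = {}" "I {c, b} \<inter> I {a, d} = {}"
      using disj[OF that(1,4)] disj[OF that(2,3)] that(5) by auto
    moreover have "p a \<in> I {a, c}" "p a \<in> I {a, d}" "p b \<in> I {c, b}" "p b \<in> I {d, b}"
      using endp that by auto
    ultimately show ?thesis by blast
  qed
  interpret theta P1 P2 P3 "p a" "p b"
    by unfold_locales (use P1 P2 P3 crossing a b' dist in auto)
  obtain D1 where D1: "connected D1" "p z \<in> D1" "p c1 \<in> D1"
    "\<And>e. e \<in> edges G \<Longrightarrow> e \<subseteq> {a, b, c2, c3} \<Longrightarrow> D1 \<inter> I e = {}"
    using link
  proof (elim disjE exE conjE, goal_cases)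
    case 1
    have "{z, c1} \<inter> {a, b, c2, c3} = {}" using dist by auto
    then have "I {z, c1} \<inter> I e = {}" if "e \<in> edges G" "e \<subseteq> {a, b, c2, c3}" for e
      using disj[OF 1(2) that(1)] that(2) by blast
    then show ?case by (intro 1(1)[of "I {z, c1}"] con endp 1(2)) auto
  next
    case (2 x)
    have "{z, x} \<inter> {a, b, c2, c3} = {}" "{x, c1} \<inter> {a, b, c2, c3} = {}"
      using dist 2(2) by auto
    then have "(I {z, x} \<union> I {x, c1}) \<inter> I e = {}" if "e \<in> edges G" "e \<subseteq> {a, b, c2, c3}" for e
      using disj[OF 2(3) that(1)] disj[OF 2(4) that(1)] that(2) by blast
    moreover have "I {z, x} \<inter> I {x, c1} \<noteq> {}" using endp[OF 2(3), of x] endp[OF 2(4), of x] by auto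
    then have "connected (I {z, x} \<union> I {x, c1})"
      by (intro connected_Un con 2)
    ultimately show ?case
      using 2(1)[of "I {z, x} \<union> I {x, c1}"] endp[OF 2(3), of z] endp[OF 2(4), of c1] by simp
  qed
  have avoid: "I {z, c} \<inter> (I {a, d} \<union> I {d, b}) = {}"
    if "{z, c} \<in> edges G" "{a, d} \<in> edges G" "{d, b} \<in> edges G" "distinct [a, b, z, c, d]" for c d
    using disj[OF that(1,2)] disj[OF that(1,3)] that(4) by auto
  have D1_avoid: "D1 \<inter> (I {a, d} \<union> I {d, b}) = {}"
    if "{a, d} \<in> edges G" "{d, b} \<in> edges G" "d \<in> {c2, c3}" for d
    using D1(4)[OF that(1)] D1(4)[OF that(2)] that(3) by auto
  show False
  proof (rule no_common_point)
    show "connected D1" "connected (I {z, c2})" "connected (I {z, c3})"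
      using D1 con z by auto
    show "p z \<in> D1" "p z \<in> I {z, c2}" "p z \<in> I {z, c3}" using D1 endp z by auto
    have "p c1 \<in> path_image P1" "p c2 \<in> path_image P2" "p c3 \<in> path_image P3"
      unfolding P1 P2 P3 using endp a by auto
    moreover have "p c2 \<in> I {z, c2}" "p c3 \<in> I {z, c3}" using endp z by auto
    ultimately show "D1 \<inter> path_image P1 \<noteq> {}" "I {z, c2} \<inter> path_image P2 \<noteq> {}"
      "I {z, c3} \<inter> path_image P3 \<noteq> {}" using D1(3) by blast+
    have "D1 \<inter> path_image P2 = {}" "D1 \<inter> path_image P3 = {}"
      unfolding P2 P3 using D1_avoid a b' by blast+
    then show "D1 \<inter> (path_image P2 \<union> path_image P3) = {}" by blast
    have "I {z, c2} \<inter> path_image P1 = {}" "I {z, c2} \<inter> path_image P3 = {}"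
      unfolding P1 P3 by (rule avoid; use z a b' dist in auto)+
    then show "I {z, c2} \<inter> (path_image P1 \<union> path_image P3) = {}" by blast
    have "I {z, c3} \<inter> path_image P1 = {}" "I {z, c3} \<inter> path_image P2 = {}"
      unfolding P1 P2 by (rule avoid; use z a b' dist in auto)+
    then show "I {z, c3} \<inter> (path_image P1 \<union> path_image P2) = {}" by blast
  qed
qed

lemma planar_graph_iso:
  assumes iso: "graph_iso G H" and "simple_edges G" and "planar H"
  shows "planar G"
proof -
  obtain f where f: "bij_betw f (verts G) (verts H)"
    and fe: "\<And>u v. u \<in> verts G \<Longrightarrow> v \<in> verts G \<Longrightarrow> {u, v} \<in> edges G \<longleftrightarrow> {f u, f v} \<in> edges H"
    using iso unfolding graph_iso_def by blast
  obtain p \<gamma> where dr: "planar_drawing H p \<gamma>" using \<open>planar H\<close> unfolding planar_def by blast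
  have inj: "inj_on f (verts G)" using f by (rule bij_betw_imp_inj_on)
  have im: "f v \<in> verts H" if "v \<in> verts G" for v using f that by (rule bij_betwE[rule_format])
  have ed: "f ` e \<in> edges H" if e: "e \<in> edges G" for e
  proof -
    obtain u v where "e = {u, v}" "u \<in> verts G" "v \<in> verts G"
      using simple_edgesE[OF \<open>simple_edges G\<close> e] by blast
    then show ?thesis using fe e by simp
  qed
  have sub: "e \<subseteq> verts G" if "e \<in> edges G" for e using simple_edgesD[OF \<open>simple_edges G\<close> that] .
  have "planar_drawing G (p \<circ> f) (\<lambda>e. \<gamma> (f ` e))"
    unfolding planar_drawing_def
  proof (intro conjI ballI impI)
    show "inj_on (p \<circ> f) (verts G)"
      using inj planar_drawingD(1)[OF dr] f by (simp add: comp_inj_on bij_betw_def)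
  next
    fix e assume e: "e \<in> edges G"
    show "arc (\<gamma> (f ` e))" by (rule planar_drawingD(2)[OF dr ed[OF e]])
    show "{pathstart (\<gamma> (f ` e)), pathfinish (\<gamma> (f ` e))} = (p \<circ> f) ` e"
      using planar_drawingD(3)[OF dr ed[OF e]] by (simp add: image_comp)
  next
    fix e v assume e: "e \<in> edges G" and v: "v \<in> verts G" and "(p \<circ> f) v \<in> path_image (\<gamma> (f ` e))"
    then have "f v \<in> f ` e" using planar_drawingD(4)[OF dr ed[OF e] im[OF v]] by simp
    then show "v \<in> e" using inj_on_image_mem_iff[OF inj v sub[OF e]] by simp
  next
    fix e e' assume e: "e \<in> edges G" "e' \<in> edges G" "e \<noteq> e'"
    then have "f ` e \<noteq> f ` e'" using inj sub by (simp add: inj_on_image_eq_iff)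
    then show "path_image (\<gamma> (f ` e)) \<inter> path_image (\<gamma> (f ` e')) \<subseteq> (p \<circ> f) ` e \<inter> (p \<circ> f) ` e'"
      using planar_drawingD(5)[OF dr ed[OF e(1)] ed[OF e(2)]] by (simp add: image_comp)
  qed
  then show ?thesis unfolding planar_def by blast
qed

section \<open>Straight-line drawings\<close>

text \<open>Twice the signed area of the triangle \<open>a, b, c\<close>. It vanishes iff the points are
  collinear, and its sign tells on which side of the line through \<open>a\<close> and \<open>b\<close> the point \<open>c\<close>
  lies.\<close>
definition turn :: "complex \<Rightarrow> complex \<Rightarrow> complex \<Rightarrow> real" where
  "turn a b c = (Re b - Re a) * (Im c - Im a) - (Im b - Im a) * (Re c - Re a)"

lemma turn_affine: "turn a b ((1 - t) *\<^sub>R c + t *\<^sub>R d) = (1 - t) * turn a b c + t * turn a b d"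
  by (simp add: turn_def algebra_simps)

lemma turn_endpoints [simp]: "turn a b a = 0" "turn a b b = 0"
  by (simp_all add: turn_def)

lemma turn_segment: "x \<in> closed_segment a b \<Longrightarrow> turn a b x = 0"
  by (auto simp: in_segment turn_affine)

lemma same_side_segments_disjoint:
  assumes "turn a b c * turn a b d > 0"
  shows "closed_segment a b \<inter> closed_segment c d = {}"
proof (rule ccontr)
  assume "\<not> ?thesis"
  then obtain x where "x \<in> closed_segment a b" "x \<in> closed_segment c d" by blast
  then obtain t where t: "0 \<le> t" "t \<le> 1" "(1 - t) * turn a b c + t * turn a b d = 0"
    using turn_segment[of x a b] by (auto simp: in_segment turn_affine)
  have "((1 - t) * turn a b c + t * turn a b d) * turn a b c = 0" using t(3) by simp
  then have "(1 - t) * (turn a b c * turn a b c) + t * (turn a b c * turn a b d) = 0"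
    by (simp add: algebra_simps)
  moreover have "(1 - t) * (turn a b c * turn a b c) \<ge> 0" using t by simp
  moreover have "t * (turn a b c * turn a b d) \<ge> 0" using t assms by simp
  ultimately have "t * (turn a b c * turn a b d) = 0" "(1 - t) * (turn a b c * turn a b c) = 0"
    by linarith+
  then show False using assms by auto
qed

lemma segments_common_end:
  assumes "turn a b c \<noteq> 0"
  shows "closed_segment a b \<inter> closed_segment a c = {a}"
proof -
  have "x = a" if x: "x \<in> closed_segment a b" "x \<in> closed_segment a c" for x
  proof -
    obtain t where "x = (1 - t) *\<^sub>R a + t *\<^sub>R c" using x(2) by (auto simp: in_segment)
    then show "x = a" using turn_segment[OF x(1)] assms by (simp add: turn_affine)
  qed
  then show ?thesis by auto
qed

text \<open>The first condition does double duty. If no third vertex is collinear with an edge, then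
  no edge passes through a foreign vertex, and two edges with a common end have no other common
  point, because their directions differ. For disjoint edges it suffices that the line through
  one of them has the other on one side.\<close>
lemma straight_line_planar:
  assumes simp: "simple_edges G" and inj: "inj_on p (verts G)"
    and off: "\<And>u v w. {u, v} \<in> edges G \<Longrightarrow> w \<in> verts G \<Longrightarrow> w \<noteq> u \<Longrightarrow> w \<noteq> v \<Longrightarrow>
      turn (p u) (p v) (p w) \<noteq> 0"
    and side: "\<And>u v w t. {u, v} \<in> edges G \<Longrightarrow> {w, t} \<in> edges G \<Longrightarrow> {u, v} \<inter> {w, t} = {} \<Longrightarrow>
      turn (p u) (p v) (p w) * turn (p u) (p v) (p t) > 0 \<or>
      turn (p w) (p t) (p u) * turn (p w) (p t) (p v) > 0"
  shows "planar G"
proof -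
  \<comment> \<open>An edge is an unordered pair, so the direction of its segment has to be chosen.\<close>
  define \<gamma> where "\<gamma> e = (SOME g. \<exists>u v. e = {u, v} \<and> g = linepath (p u) (p v))" for e
  have \<gamma>: "\<gamma> {u, v} = linepath (p u) (p v) \<or> \<gamma> {u, v} = linepath (p v) (p u)" for u v
  proof -
    let ?P = "\<lambda>g. \<exists>x y. {u, v} = {x, y} \<and> g = linepath (p x) (p y)"
    have "?P (\<gamma> {u, v})"
      unfolding \<gamma>_def by (rule someI[of ?P "linepath (p u) (p v)"]) (rule exI[of _ u], rule exI[of _ v], simp)
    then obtain x y where "{u, v} = {x, y}" "\<gamma> {u, v} = linepath (p x) (p y)" by (elim exE conjE)
    then show ?thesis unfolding doubleton_eq_iff by (elim disjE conjE) simp_all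
  qed
  have ends: "{pathstart (\<gamma> {u, v}), pathfinish (\<gamma> {u, v})} = {p u, p v}"
    and img: "path_image (\<gamma> {u, v}) = closed_segment (p u) (p v)"
    and ar: "p u \<noteq> p v \<Longrightarrow> arc (\<gamma> {u, v})" for u v
    using \<gamma>[of u v] by (elim disjE; simp add: insert_commute closed_segment_commute)+
  have "planar_drawing G p \<gamma>"
    unfolding planar_drawing_def
  proof (intro conjI ballI impI)
    show "inj_on p (verts G)" by (rule inj)
  next
    fix e assume "e \<in> edges G"
    then obtain u v where e: "e = {u, v}" "u \<noteq> v" "u \<in> verts G" "v \<in> verts G"
      by (rule simple_edgesE[OF simp])
    then have "p u \<noteq> p v" using inj by (auto dest: inj_onD)
    then show "arc (\<gamma> e)" "{pathstart (\<gamma> e), pathfinish (\<gamma> e)} = p ` e"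
      using ar ends by (simp_all add: e)
  next
    fix e w assume e': "e \<in> edges G" and w: "w \<in> verts G" "p w \<in> path_image (\<gamma> e)"
    from e' obtain u v where e: "e = {u, v}" by (rule simple_edgesE[OF simp])
    have "turn (p u) (p v) (p w) = 0" using w(2) by (auto simp: e img intro: turn_segment)
    then show "w \<in> e" using off[of u v w] e' w(1) by (auto simp: e)
  next
    fix e e' assume ee: "e \<in> edges G" "e' \<in> edges G" "e \<noteq> e'"
    obtain u v where e: "e = {u, v}" "u \<noteq> v" "u \<in> verts G" "v \<in> verts G"
      by (rule simple_edgesE[OF simp ee(1)])
    obtain w t where e': "e' = {w, t}" "w \<noteq> t" "w \<in> verts G" "t \<in> verts G"
      by (rule simple_edgesE[OF simp ee(2)])
    have share: "path_image (\<gamma> {a, b}) \<inter> path_image (\<gamma> {a, c}) \<subseteq> p ` {a, b} \<inter> p ` {a, c}"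
      if "{a, b} \<in> edges G" "c \<in> verts G" "c \<noteq> a" "c \<noteq> b" for a b c
      using segments_common_end[OF off[OF that]] by (simp add: img)
    show "path_image (\<gamma> e) \<inter> path_image (\<gamma> e') \<subseteq> p ` e \<inter> p ` e'"
    proof (cases "e \<inter> e' = {}")
      case True
      then show ?thesis
        using side[of u v w t] ee
          same_side_segments_disjoint[of "p u" "p v" "p w" "p t"]
          same_side_segments_disjoint[of "p w" "p t" "p u" "p v"]
        by (auto simp: e e' img)
    next
      case False
      then obtain a where "a \<in> e" "a \<in> e'" by blast
      then obtain b c where "e = {a, b}" "e' = {a, c}" "c \<noteq> a" "c \<in> verts G"
        using e e' by (auto simp: doubleton_eq_iff)
      then show ?thesis using share[of a b c] ee by auto
    qed
  qed
  then show ?thesis unfolding planar_def by blast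
qed

section \<open>Graphs of orthogonal vectors that are not planar\<close>

lemma TD_verts:
  "x \<in> verts (TD R n) \<longleftrightarrow> x \<in> {1..n} \<rightarrow>\<^sub>E carrier R \<and> (\<exists>i\<in>{1..n}. x i \<noteq> \<zero>\<^bsub>R\<^esub>)"
proof -
  have "x = (\<lambda>i\<in>{1..n}. \<zero>\<^bsub>R\<^esub>) \<longleftrightarrow> (\<forall>i\<in>{1..n}. x i = \<zero>\<^bsub>R\<^esub>)" if "x \<in> {1..n} \<rightarrow>\<^sub>E carrier R"
    using PiE_arb[OF that] by (auto simp: fun_eq_iff restrict_def)
  then show ?thesis unfolding TD_def Let_def by auto
qed

lemma TD_coord: "x \<in> verts (TD R n) \<Longrightarrow> i \<in> {1..n} \<Longrightarrow> x i \<in> carrier R"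
  by (auto simp: TD_verts)

lemma TD_verts_ext:
  assumes "x \<in> verts (TD R n)" "y \<in> verts (TD R n)" "\<And>i. i \<in> {1..n} \<Longrightarrow> x i = y i"
  shows "x = y"
proof (rule PiE_ext)
  show "x \<in> {1..n} \<rightarrow>\<^sub>E carrier R" "y \<in> {1..n} \<rightarrow>\<^sub>E carrier R"
    using assms(1,2) by (simp_all add: TD_verts)
qed (rule assms(3))

lemma dot_commute:
  assumes "cring R" "x \<in> verts (TD R n)" "y \<in> verts (TD R n)"
  shows "dot R n x y = dot R n y x"
proof -
  interpret cring R by fact
  show ?thesis
    unfolding dot_def using TD_coord[OF assms(2)] TD_coord[OF assms(3)]
    by (intro finsum_cong') (auto simp: m_comm)
qed

lemma TD_edges:
  assumes "cring R"
  shows "{x, y} \<in> edges (TD R n) \<longleftrightarrow>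
    x \<in> verts (TD R n) \<and> y \<in> verts (TD R n) \<and> x \<noteq> y \<and> dot R n x y = \<zero>\<^bsub>R\<^esub>"
proof -
  have "{x, y} \<in> edges (TD R n) \<longleftrightarrow> (\<exists>u v. {x, y} = {u, v} \<and> u \<in> verts (TD R n) \<and>
      v \<in> verts (TD R n) \<and> u \<noteq> v \<and> dot R n u v = \<zero>\<^bsub>R\<^esub>)"
    by (simp add: TD_def Let_def)
  then show ?thesis using dot_commute[OF assms, of x n y] by (auto simp: doubleton_eq_iff)
qed

lemma TD_simple_edges: "simple_edges (TD R n)"
  unfolding simple_edges_def TD_def Let_def by auto

text \<open>All the edges used to establish nonplanarity come from this lemma, which uses
  no arithmetic beyond products with zero. This is why the nonplanarity results below only count
  nonzero elements.\<close>
lemma disjoint_support_edge: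
  assumes "cring R" "x \<in> verts (TD R n)" "y \<in> verts (TD R n)"
    and disj: "\<And>i. i \<in> {1..n} \<Longrightarrow> x i = \<zero>\<^bsub>R\<^esub> \<or> y i = \<zero>\<^bsub>R\<^esub>"
  shows "{x, y} \<in> edges (TD R n)"
proof -
  interpret cring R by fact
  have "dot R n x y = \<zero>\<^bsub>R\<^esub>"
    unfolding dot_def
  proof (rule add.finprod_one_eqI)
    fix i assume "i \<in> {1..n}"
    then show "x i \<otimes>\<^bsub>R\<^esub> y i = \<zero>\<^bsub>R\<^esub>"
      using disj TD_coord[OF assms(2)] TD_coord[OF assms(3)] by fastforce
  qed
  moreover have "x \<noteq> y" using assms(2) disj by (auto simp: TD_verts)
  ultimately show ?thesis using assms by (simp add: TD_edges)
qed

text \<open>A short list stands for the vector with these leading entries, padded with zeros, so that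
  configurations found in a small dimension carry over to every larger one.\<close>
definition vec :: "('a, 'b) ring_scheme \<Rightarrow> nat \<Rightarrow> 'a list \<Rightarrow> nat \<Rightarrow> 'a" where
  "vec R n xs = (\<lambda>i\<in>{1..n}. if i \<le> length xs then xs ! (i - 1) else \<zero>\<^bsub>R\<^esub>)"

lemma vec_eq_iff:
  assumes "length xs = length ys" "length ys \<le> n"
  shows "vec R n xs = vec R n ys \<longleftrightarrow> xs = ys"
proof
  assume eq: "vec R n xs = vec R n ys"
  show "xs = ys"
  proof (rule nth_equalityI)
    fix i assume "i < length xs"
    then show "xs ! i = ys ! i" using fun_cong[OF eq, of "Suc i"] assms by (simp add: vec_def)
  qed (rule assms(1))
qed simp

lemma vec_in_verts:
  assumes "cring R" "length xs \<le> n" "set xs \<subseteq> carrier R" "\<exists>x\<in>set xs. x \<noteq> \<zero>\<^bsub>R\<^esub>"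
  shows "vec R n xs \<in> verts (TD R n)"
proof -
  interpret cring R by fact
  obtain k where "k < length xs" "xs ! k \<noteq> \<zero>\<^bsub>R\<^esub>" using assms(4) by (auto simp: in_set_conv_nth)
  then have "\<exists>i\<in>{1..n}. vec R n xs i \<noteq> \<zero>\<^bsub>R\<^esub>"
    using assms(2) by (intro bexI[of _ "Suc k"]) (auto simp: vec_def)
  moreover have "xs ! (i - 1) \<in> carrier R" if "1 \<le> i" "i \<le> length xs" for i
    using that assms(3) nth_mem[of "i - 1" xs] by auto
  ultimately show ?thesis by (auto simp: TD_verts vec_def)
qed

lemma vec_edge:
  assumes "cring R" "length xs \<le> n" "set xs \<subseteq> carrier R" "set ys \<subseteq> carrier R"
    "\<exists>x\<in>set xs. x \<noteq> \<zero>\<^bsub>R\<^esub>" "\<exists>y\<in>set ys. y \<noteq> \<zero>\<^bsub>R\<^esub>"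
    and disj: "list_all2 (\<lambda>x y. x = \<zero>\<^bsub>R\<^esub> \<or> y = \<zero>\<^bsub>R\<^esub>) xs ys"
  shows "{vec R n xs, vec R n ys} \<in> edges (TD R n)"
proof (rule disjoint_support_edge)
  have len: "length ys = length xs" using disj by (simp add: list_all2_lengthD)
  show "vec R n xs \<in> verts (TD R n)" "vec R n ys \<in> verts (TD R n)"
    using assms len by (auto intro!: vec_in_verts)
  fix i assume "i \<in> {1..n}"
  then show "vec R n xs i = \<zero>\<^bsub>R\<^esub> \<or> vec R n ys i = \<zero>\<^bsub>R\<^esub>"
    using list_all2_nthD[OF disj, of "i - 1"] len by (auto simp: vec_def)
qed fact

text \<open>The three nonzero multiples of the first unit vector are orthogonal to those of the second,
  which makes a copy of \<open>K\<^sub>3\<^sub>,\<^sub>3\<close>.\<close>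
lemma three_nonzero_not_planar:
  assumes "cring R" "n \<ge> 2" "{s, t, u} \<subseteq> carrier R - {\<zero>\<^bsub>R\<^esub>}" "distinct [s, t, u]"
  shows "\<not> planar (TD R n)"
proof -
  interpret cring R by fact
  let ?z = "\<zero>\<^bsub>R\<^esub>" and ?v = "vec R n"
  show ?thesis
    by (rule subdivided_K33_not_planar[where a = "?v [s, ?z]" and b = "?v [t, ?z]" and z = "?v [u, ?z]"
          and ?c1.0 = "?v [?z, s]" and ?c2.0 = "?v [?z, t]" and ?c3.0 = "?v [?z, u]"])
      (use assms in \<open>auto simp: vec_eq_iff TD_simple_edges intro!: vec_edge\<close>)
qed

text \<open>The multiples by \<open>s\<close> and \<open>t\<close> of the three unit vectors contain an octahedron: any two on
  different axes are adjacent. An edge between the two vertices of the first axis is replaced by a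
  path through a vector supported on the other two coordinates. Now \<open>K\<^sub>3\<^sub>,\<^sub>3\<close>
  appears, with one vertex of the first axis and both vertices of the second axis on one side, and
  the remaining three vertices on the other.\<close>
lemma two_nonzero_not_planar:
  assumes "cring R" "n \<ge> 3" "{s, t} \<subseteq> carrier R - {\<zero>\<^bsub>R\<^esub>}" "s \<noteq> t"
  shows "\<not> planar (TD R n)"
proof -
  interpret cring R by fact
  let ?z = "\<zero>\<^bsub>R\<^esub>" and ?v = "vec R n"
  have "\<exists>x. x \<notin> {?v [?z, s, ?z], ?v [?z, t, ?z], ?v [?z, ?z, s], ?v [?z, ?z, t]} \<and>
      {?v [s, ?z, ?z], x} \<in> edges (TD R n) \<and> {x, ?v [t, ?z, ?z]} \<in> edges (TD R n)"
    using assms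
    by (intro exI[of _ "?v [?z, s, s]"]) (auto simp: vec_eq_iff intro!: vec_edge)
  then show ?thesis
    by (intro subdivided_K33_not_planar[where a = "?v [?z, s, ?z]" and b = "?v [?z, t, ?z]"
          and z = "?v [s, ?z, ?z]" and ?c1.0 = "?v [t, ?z, ?z]" and ?c2.0 = "?v [?z, ?z, s]"
          and ?c3.0 = "?v [?z, ?z, t]"])
      (use assms in \<open>auto simp: vec_eq_iff TD_simple_edges intro!: vec_edge\<close>)
qed

text \<open>With \<open>0\<close> and \<open>s\<close> as the only entries there are three nonzero vectors supported on the first
  two coordinates and three on the next two.\<close>
lemma dimension_four_not_planar:
  assumes "cring R" "n \<ge> 4" "s \<in> carrier R" "s \<noteq> \<zero>\<^bsub>R\<^esub>"
  shows "\<not> planar (TD R n)"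
proof -
  interpret cring R by fact
  let ?z = "\<zero>\<^bsub>R\<^esub>" and ?v = "vec R n"
  show ?thesis
    by (rule subdivided_K33_not_planar[where a = "?v [s, ?z, ?z, ?z]" and b = "?v [?z, s, ?z, ?z]"
          and z = "?v [s, s, ?z, ?z]" and ?c1.0 = "?v [?z, ?z, s, ?z]"
          and ?c2.0 = "?v [?z, ?z, ?z, s]" and ?c3.0 = "?v [?z, ?z, s, s]"])
      (use assms in \<open>auto simp: vec_eq_iff TD_simple_edges intro!: vec_edge\<close>)
qed

text \<open>Otherwise the ring, which may be infinite, has three nonzero elements, and
  \<open>three_nonzero_not_planar\<close> applies.\<close>
lemma planar_imp_few_elements:
  assumes "cring R" "n \<ge> 2" "planar (TD R n)"
  shows "finite (carrier R)" "card (carrier R) \<le> 3"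
proof -
  interpret cring R by fact
  let ?N = "carrier R - {\<zero>\<^bsub>R\<^esub>}"
  have no3: "\<not> (T \<subseteq> ?N \<and> card T = 3)" for T
    using three_nonzero_not_planar[OF assms(1,2)] assms(3) by (auto simp: card_3_iff)
  have "finite ?N" using infinite_arbitrarily_large[of ?N 3] no3 by blast
  moreover have "\<not> 3 \<le> card ?N" using obtain_subset_with_card_n[of 3 ?N] no3 by metis
  ultimately show "finite (carrier R)" "card (carrier R) \<le> 3"
    using card_Suc_Diff1[of "carrier R" "\<zero>\<^bsub>R\<^esub>"] by auto
qed

section \<open>Isomorphic rings have isomorphic graphs\<close>

lemma graph_iso_TD:
  assumes "cring R" "cring S" "h \<in> ring_hom R S" "bij_betw h (carrier R) (carrier S)"
  shows "graph_iso (TD R n) (TD S n)"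
proof -
  interpret ring_hom_cring R S h
    using assms by (intro ring_hom_cring.intro ring_hom_cring_axioms.intro)
  have inj: "inj_on h (carrier R)" and img: "h ` carrier R = carrier S"
    using assms(4) by (auto simp: bij_betw_def)
  have h_eq: "h a = h b \<longleftrightarrow> a = b" if "a \<in> carrier R" "b \<in> carrier R" for a b
    using inj that by (auto dest: inj_onD)
  have h_0: "h a = \<zero>\<^bsub>S\<^esub> \<longleftrightarrow> a = \<zero>\<^bsub>R\<^esub>" if "a \<in> carrier R" for a
    using h_eq[of a "\<zero>\<^bsub>R\<^esub>"] that by simp
  define F where "F x = (\<lambda>i\<in>{1..n}. h (x i))" for x
  have F_verts: "F x \<in> verts (TD S n)" if "x \<in> verts (TD R n)" for x
    using that h_0 by (auto simp: F_def TD_verts PiE_mem)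
  have F_eq: "F x = F y \<longleftrightarrow> x = y" if "x \<in> verts (TD R n)" "y \<in> verts (TD R n)" for x y
  proof
    assume "F x = F y"
    then have "h (x i) = h (y i)" if "i \<in> {1..n}" for i
      using that by (metis F_def restrict_apply')
    then show "x = y" using TD_verts_ext[OF that] TD_coord that h_eq by metis
  qed simp
  have F_surj: "\<exists>x\<in>verts (TD R n). F x = y" if y: "y \<in> verts (TD S n)" for y
  proof -
    define x where "x = (\<lambda>i\<in>{1..n}. inv_into (carrier R) h (y i))"
    have yi: "y i \<in> h ` carrier R" if "i \<in> {1..n}" for i
      using TD_coord[OF y that] img by simp
    have x: "x i \<in> carrier R" "h (x i) = y i" if "i \<in> {1..n}" for i
      using inv_into_into[OF yi[OF that]] f_inv_into_f[OF yi[OF that]] that by (simp_all add: x_def)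
    obtain j where "j \<in> {1..n}" "y j \<noteq> \<zero>\<^bsub>S\<^esub>" using y by (auto simp: TD_verts)
    then have "x j \<noteq> \<zero>\<^bsub>R\<^esub>" using x h_0 by metis
    moreover have "x \<in> {1..n} \<rightarrow>\<^sub>E carrier R"
      using x(1) unfolding x_def by (intro restrict_PiE[THEN iffD2]) auto
    ultimately have xv: "x \<in> verts (TD R n)" using \<open>j \<in> {1..n}\<close> by (auto simp: TD_verts)
    have "F x = y"
      by (rule TD_verts_ext[OF F_verts[OF xv] y]) (simp add: F_def x)
    then show ?thesis using xv by blast
  qed
  have F_dot: "dot S n (F x) (F y) = h (dot R n x y)"
    if "x \<in> verts (TD R n)" "y \<in> verts (TD R n)" for x y
  proof -
    have "h (dot R n x y) = (\<Oplus>\<^bsub>S\<^esub>i\<in>{1..n}. (h \<circ> (\<lambda>i. x i \<otimes>\<^bsub>R\<^esub> y i)) i)"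
      unfolding dot_def using TD_coord[OF that(1)] TD_coord[OF that(2)] by (intro hom_finsum) auto
    also have "\<dots> = dot S n (F x) (F y)"
      unfolding dot_def using TD_coord[OF that(1)] TD_coord[OF that(2)]
      by (intro S.finsum_cong') (auto simp: F_def)
    finally show ?thesis by simp
  qed
  have dot_R: "dot R n x y \<in> carrier R" if "x \<in> verts (TD R n)" "y \<in> verts (TD R n)" for x y
    unfolding dot_def using TD_coord[OF that(1)] TD_coord[OF that(2)] by (intro R.finsum_closed) auto
  show ?thesis
    unfolding graph_iso_def
  proof (intro exI[of _ F] conjI ballI)
    show "bij_betw F (verts (TD R n)) (verts (TD S n))"
    proof (rule bij_betw_imageI)
      show "inj_on F (verts (TD R n))" using F_eq by (auto intro!: inj_onI)
      show "F ` verts (TD R n) = verts (TD S n)" using F_verts F_surj by fast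
    qed
    fix u v assume uv: "u \<in> verts (TD R n)" "v \<in> verts (TD R n)"
    then show "({u, v} \<in> edges (TD R n)) = ({F u, F v} \<in> edges (TD S n))"
      using F_verts by (simp add: TD_edges assms F_eq F_dot h_0 dot_R)
  qed
qed

section \<open>Rings with two or three elements\<close>

text \<open>In a ring with two elements, \<open>1 + 1\<close> differs from \<open>1\<close> and is therefore zero.\<close>
lemma two_element_ring_iso:
  assumes "cring R" "card (carrier R) = 2" "\<one>\<^bsub>R\<^esub> \<noteq> \<zero>\<^bsub>R\<^esub>"
  obtains h where "h \<in> ring_hom R (residue_ring 2)" "bij_betw h (carrier R) (carrier (residue_ring 2))"
proof -
  interpret cring R by fact
  have "carrier R = {\<zero>\<^bsub>R\<^esub>, \<one>\<^bsub>R\<^esub>}"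
  proof (rule sym, rule card_subset_eq)
    show "finite (carrier R)" using assms(2) card.infinite by fastforce
  qed (use assms in auto)
  note car = this
  have "\<one>\<^bsub>R\<^esub> \<oplus>\<^bsub>R\<^esub> \<one>\<^bsub>R\<^esub> \<noteq> \<one>\<^bsub>R\<^esub>"
    using assms(3) add.l_cancel_one[of "\<one>\<^bsub>R\<^esub>" "\<one>\<^bsub>R\<^esub>"] by simp
  moreover have "\<one>\<^bsub>R\<^esub> \<oplus>\<^bsub>R\<^esub> \<one>\<^bsub>R\<^esub> \<in> {\<zero>\<^bsub>R\<^esub>, \<one>\<^bsub>R\<^esub>}" unfolding car[symmetric] by simp
  ultimately have two: "\<one>\<^bsub>R\<^esub> \<oplus>\<^bsub>R\<^esub> \<one>\<^bsub>R\<^esub> = \<zero>\<^bsub>R\<^esub>" by blast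
  define h :: "'a \<Rightarrow> int" where "h x = (if x = \<zero>\<^bsub>R\<^esub> then 0 else 1)" for x
  have "h \<in> ring_hom R (residue_ring 2)"
    by (rule ring_hom_memI) (use assms(3) two in \<open>auto simp: h_def car residue_ring_def\<close>)
  moreover have "{0..1} = {0, 1::int}" by auto
  then have "bij_betw h (carrier R) (carrier (residue_ring 2))"
    using assms(3) by (auto simp: bij_betw_def inj_on_def car h_def residue_ring_def)
  ultimately show thesis by (rule that)
qed

text \<open>The element \<open>a = 1 + 1\<close> is different from \<open>1\<close>. It is also nonzero: otherwise, with \<open>b\<close>
  the third element, \<open>b + 1\<close> differs from \<open>1\<close>, from \<open>b\<close> and from \<open>1 + 1 = 0\<close>, and no value
  is left for it. So the carrier is \<open>{0, 1, a}\<close>, and all sums and products are forced.\<close>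
lemma three_element_ring_iso:
  assumes "cring R" "card (carrier R) = 3" "\<one>\<^bsub>R\<^esub> \<noteq> \<zero>\<^bsub>R\<^esub>"
  obtains h where "h \<in> ring_hom R (residue_ring 3)" "bij_betw h (carrier R) (carrier (residue_ring 3))"
proof -
  interpret cring R by fact
  define a where "a = \<one>\<^bsub>R\<^esub> \<oplus>\<^bsub>R\<^esub> \<one>\<^bsub>R\<^esub>"
  have a: "a \<in> carrier R" by (simp add: a_def)
  have fin: "finite (carrier R)" using assms(2) card.infinite by fastforce
  have a1: "a \<noteq> \<one>\<^bsub>R\<^esub>" using assms(3) add.l_cancel_one[of "\<one>\<^bsub>R\<^esub>" "\<one>\<^bsub>R\<^esub>"] by (simp add: a_def)
  have a0: "a \<noteq> \<zero>\<^bsub>R\<^esub>"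
  proof
    assume a0: "a = \<zero>\<^bsub>R\<^esub>"
    have "\<not> carrier R \<subseteq> {\<zero>\<^bsub>R\<^esub>, \<one>\<^bsub>R\<^esub>}"
      using assms(2,3) card_mono[of "{\<zero>\<^bsub>R\<^esub>, \<one>\<^bsub>R\<^esub>}" "carrier R"] by auto
    then obtain b where b: "b \<in> carrier R" "b \<noteq> \<zero>\<^bsub>R\<^esub>" "b \<noteq> \<one>\<^bsub>R\<^esub>" by blast
    have car: "carrier R = {\<zero>\<^bsub>R\<^esub>, \<one>\<^bsub>R\<^esub>, b}"
      by (rule sym, rule card_subset_eq[OF fin]) (use assms(2,3) b in auto)
    have "b \<oplus>\<^bsub>R\<^esub> \<one>\<^bsub>R\<^esub> \<in> {\<zero>\<^bsub>R\<^esub>, \<one>\<^bsub>R\<^esub>, b}" unfolding car[symmetric] using b by simp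
    moreover have "b \<oplus>\<^bsub>R\<^esub> \<one>\<^bsub>R\<^esub> \<noteq> \<one>\<^bsub>R\<^esub>" "b \<oplus>\<^bsub>R\<^esub> \<one>\<^bsub>R\<^esub> \<noteq> b"
      using b assms(3) by (simp_all add: add.l_cancel_one add.r_cancel_one)
    moreover have "b \<oplus>\<^bsub>R\<^esub> \<one>\<^bsub>R\<^esub> \<noteq> \<one>\<^bsub>R\<^esub> \<oplus>\<^bsub>R\<^esub> \<one>\<^bsub>R\<^esub>" using b by simp
    ultimately show False using a0 by (auto simp: a_def)
  qed
  have car: "carrier R = {\<zero>\<^bsub>R\<^esub>, \<one>\<^bsub>R\<^esub>, a}"
    by (rule sym, rule card_subset_eq[OF fin]) (use assms(2,3) a a0 a1 in auto)
  have "a \<oplus>\<^bsub>R\<^esub> \<one>\<^bsub>R\<^esub> \<in> {\<zero>\<^bsub>R\<^esub>, \<one>\<^bsub>R\<^esub>, a}" unfolding car[symmetric] using a by simp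
  moreover have "a \<oplus>\<^bsub>R\<^esub> \<one>\<^bsub>R\<^esub> \<noteq> \<one>\<^bsub>R\<^esub>" "a \<oplus>\<^bsub>R\<^esub> \<one>\<^bsub>R\<^esub> \<noteq> a"
    using a a0 assms(3) by (simp_all add: add.l_cancel_one add.r_cancel_one)
  ultimately have s1: "a \<oplus>\<^bsub>R\<^esub> \<one>\<^bsub>R\<^esub> = \<zero>\<^bsub>R\<^esub>" by blast
  then have s1': "\<one>\<^bsub>R\<^esub> \<oplus>\<^bsub>R\<^esub> a = \<zero>\<^bsub>R\<^esub>" using a by (simp add: a_comm)
  have s2: "a \<oplus>\<^bsub>R\<^esub> a = \<one>\<^bsub>R\<^esub>"
  proof -
    have "a \<oplus>\<^bsub>R\<^esub> a = (a \<oplus>\<^bsub>R\<^esub> \<one>\<^bsub>R\<^esub>) \<oplus>\<^bsub>R\<^esub> \<one>\<^bsub>R\<^esub>" using a by (simp add: a_def a_assoc)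
    then show ?thesis using s1 by simp
  qed
  have m: "a \<otimes>\<^bsub>R\<^esub> a = \<one>\<^bsub>R\<^esub>"
  proof -
    have "a \<otimes>\<^bsub>R\<^esub> a = (\<one>\<^bsub>R\<^esub> \<oplus>\<^bsub>R\<^esub> \<one>\<^bsub>R\<^esub>) \<otimes>\<^bsub>R\<^esub> a" by (simp add: a_def)
    also have "\<dots> = a \<oplus>\<^bsub>R\<^esub> a" using a by (simp add: l_distr)
    finally show ?thesis using s2 by simp
  qed
  define h :: "'a \<Rightarrow> int" where "h x = (if x = \<zero>\<^bsub>R\<^esub> then 0 else if x = \<one>\<^bsub>R\<^esub> then 1 else 2)" for x
  have h: "h \<zero>\<^bsub>R\<^esub> = 0" "h \<one>\<^bsub>R\<^esub> = 1" "h a = 2" using assms(3) a0 a1 by (simp_all add: h_def)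
  have "h \<in> ring_hom R (residue_ring 3)"
  proof (rule ring_hom_memI)
    fix x y assume "x \<in> carrier R" "y \<in> carrier R"
    then have xy: "x \<in> {\<zero>\<^bsub>R\<^esub>, \<one>\<^bsub>R\<^esub>, a}" "y \<in> {\<zero>\<^bsub>R\<^esub>, \<one>\<^bsub>R\<^esub>, a}" unfolding car by simp_all
    then show "h x \<in> carrier (residue_ring 3)"
      by (elim insertE emptyE) (simp_all add: h residue_ring_def)
    show "h (x \<otimes>\<^bsub>R\<^esub> y) = h x \<otimes>\<^bsub>residue_ring 3\<^esub> h y"
      using xy by (elim insertE emptyE) (simp_all add: h a m residue_ring_def)
    show "h (x \<oplus>\<^bsub>R\<^esub> y) = h x \<oplus>\<^bsub>residue_ring 3\<^esub> h y"
      using xy by (elim insertE emptyE)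
        (simp_all add: h a s1 s1' s2 a_def[symmetric] residue_ring_def)
  qed (simp add: h residue_ring_def)
  moreover have "{0..2} = {0, 1, 2::int}" by auto
  then have "bij_betw h (carrier R) (carrier (residue_ring 3))"
    by (simp add: bij_betw_def inj_on_def car h residue_ring_def)
  ultimately show thesis by (rule that)
qed

section \<open>Drawings of the three planar graphs\<close>
lemma sum_list_upt_shift:
  "sum_list (map2 (*) (map x [1..<Suc n]) (map y [1..<Suc n])) = (\<Sum>i\<in>{1..n}. x i * y i)"
  for x y :: "nat \<Rightarrow> int"
  by (simp add: map2_map_map interv_sum_list_conv_sum_set_nat atLeastLessThanSuc_atLeastAtMost del: upt_Suc)

lemma dot_residue:
  assumes "m > 1"
  shows "dot (residue_ring m) n x y = sum_list (map2 (*) (map x [1..<Suc n]) (map y [1..<Suc n])) mod m"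
proof -
  interpret residues m "residue_ring m" using assms by unfold_locales auto
  have "dot (residue_ring m) n x y = (\<Oplus>\<^bsub>residue_ring m\<^esub>i\<in>{1..n}. (x i * y i) mod m)"
    by (simp add: dot_def res_mult_eq)
  also have "\<dots> = (\<Sum>i\<in>{1..n}. x i * y i) mod m" by (rule sum_cong) simp
  finally show ?thesis by (simp only: sum_list_upt_shift)
qed

text \<open>The vectors over the integers modulo \<open>m\<close> are listed by their tuples of coordinates, which
  turns the conditions on a straight-line drawing with integral vertices into a finite computation.\<close>
definition residue_vectors :: "int \<Rightarrow> nat \<Rightarrow> int list list" where
  "residue_vectors m n = filter (\<lambda>xs. \<exists>x\<in>set xs. x \<noteq> 0) (List.n_lists n [0..m - 1])"

definition orthogonal_mod :: "int \<Rightarrow> int list \<Rightarrow> int list \<Rightarrow> bool" where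
  "orthogonal_mod m xs ys \<longleftrightarrow> xs \<noteq> ys \<and> sum_list (map2 (*) xs ys) mod m = 0"

text \<open>The integral counterpart of \<open>turn\<close>.\<close>
definition orient :: "int \<times> int \<Rightarrow> int \<times> int \<Rightarrow> int \<times> int \<Rightarrow> int" where
  "orient a b c = (fst b - fst a) * (snd c - snd a) - (snd b - snd a) * (fst c - fst a)"

text \<open>The requirements of \<open>straight_line_planar\<close>, when the vertex with coordinates \<open>xs\<close> is put
  at the point \<open>q xs\<close>.\<close>
definition grid_drawing :: "int \<Rightarrow> nat \<Rightarrow> (int list \<Rightarrow> int \<times> int) \<Rightarrow> bool" where
  "grid_drawing m n q \<longleftrightarrow>
     (let V = residue_vectors m n in
      distinct (map q V) \<and>
      (\<forall>a\<in>set V. \<forall>b\<in>set V. orthogonal_mod m a b \<longrightarrow>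
        (\<forall>c\<in>set V. c \<noteq> a \<longrightarrow> c \<noteq> b \<longrightarrow> orient (q a) (q b) (q c) \<noteq> 0) \<and>
        (\<forall>c\<in>set V. \<forall>d\<in>set V. orthogonal_mod m c d \<longrightarrow> {a, b} \<inter> {c, d} = {} \<longrightarrow>
          orient (q a) (q b) (q c) * orient (q a) (q b) (q d) > 0 \<or>
          orient (q c) (q d) (q a) * orient (q c) (q d) (q b) > 0)))"


lemma grid_drawing_planar:
  assumes "m > 1" and grid: "grid_drawing m n q"
  shows "planar (TD (residue_ring m) n)"
proof -
  interpret residues m "residue_ring m" using assms by unfold_locales auto
  let ?G = "TD (residue_ring m) n"
  define c where "c x = map x [1..<Suc n]" for x :: "nat \<Rightarrow> int"
  define p where "p x = Complex (of_int (fst (q (c x)))) (of_int (snd (q (c x))))" for x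
  define V where "V = set (residue_vectors m n)"
  have cV: "c x \<in> V" if "x \<in> verts ?G" for x
  proof -
    have set_c: "set (c x) = x ` {1..n}"
      by (simp add: c_def atLeastLessThanSuc_atLeastAtMost del: upt_Suc)
    have "set (c x) \<subseteq> {0..m - 1}" "\<exists>k\<in>set (c x). k \<noteq> 0"
      using that unfolding set_c by (auto simp: TD_verts res_carrier_eq res_zero_eq)
    moreover have "length (c x) = n" by (simp add: c_def del: upt_Suc)
    ultimately show ?thesis by (simp add: V_def residue_vectors_def set_n_lists)
  qed
  have c_eq: "c x = c y \<longleftrightarrow> x = y" if "x \<in> verts ?G" "y \<in> verts ?G" for x y
    using TD_verts_ext[OF that] by (auto simp: c_def simp del: upt_Suc)
  have orth: "orthogonal_mod m (c x) (c y)" if "{x, y} \<in> edges ?G" for x y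
    using that assms(1) c_eq[of x y] unfolding TD_edges[OF cring] dot_residue[OF assms(1)]
    by (simp add: orthogonal_mod_def c_def res_zero_eq del: upt_Suc)
  have turn_p: "turn (p x) (p y) (p z) = of_int (orient (q (c x)) (q (c y)) (q (c z)))" for x y z
    by (simp add: turn_def orient_def p_def)
  have inj: "inj_on q V"
    and off: "\<And>a b d. a \<in> V \<Longrightarrow> b \<in> V \<Longrightarrow> d \<in> V \<Longrightarrow> orthogonal_mod m a b \<Longrightarrow> d \<noteq> a \<Longrightarrow> d \<noteq> b \<Longrightarrow>
      orient (q a) (q b) (q d) \<noteq> 0"
    and side: "\<And>a b d e. a \<in> V \<Longrightarrow> b \<in> V \<Longrightarrow> d \<in> V \<Longrightarrow> e \<in> V \<Longrightarrow> orthogonal_mod m a b \<Longrightarrow>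
      orthogonal_mod m d e \<Longrightarrow> {a, b} \<inter> {d, e} = {} \<Longrightarrow>
      orient (q a) (q b) (q d) * orient (q a) (q b) (q e) > 0 \<or>
      orient (q d) (q e) (q a) * orient (q d) (q e) (q b) > 0"
    using grid unfolding grid_drawing_def Let_def V_def distinct_map by blast+
  have vert: "x \<in> verts ?G" if "{x, y} \<in> edges ?G \<or> {y, x} \<in> edges ?G" for x y
    using that by (auto simp: TD_edges[OF cring])
  show ?thesis
  proof (rule straight_line_planar[where p = p])
    show "simple_edges ?G" by (rule TD_simple_edges)
    show "inj_on p (verts ?G)"
    proof (rule inj_onI)
      fix x y assume xy: "x \<in> verts ?G" "y \<in> verts ?G" "p x = p y"
      then have "q (c x) = q (c y)" by (simp add: p_def prod_eq_iff)
      then show "x = y" using inj cV c_eq xy by (metis inj_onD)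
    qed
  next
    fix u v w assume e: "{u, v} \<in> edges ?G" and w: "w \<in> verts ?G" "w \<noteq> u" "w \<noteq> v"
    have uv: "u \<in> verts ?G" "v \<in> verts ?G" using e by (auto simp: TD_edges[OF cring])
    then show "turn (p u) (p v) (p w) \<noteq> 0"
      using off[OF cV[OF uv(1)] cV[OF uv(2)] cV[OF w(1)] orth[OF e]] w
      by (simp add: turn_p c_eq)
  next
    fix u v w t assume e: "{u, v} \<in> edges ?G" "{w, t} \<in> edges ?G" "{u, v} \<inter> {w, t} = {}"
    have vs: "u \<in> verts ?G" "v \<in> verts ?G" "w \<in> verts ?G" "t \<in> verts ?G"
      using e(1,2) by (simp_all add: TD_edges[OF cring])
    have "{c u, c v} \<inter> {c w, c t} = {}" using e(3) vs by (auto simp: c_eq)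
    then show "turn (p u) (p v) (p w) * turn (p u) (p v) (p t) > 0 \<or>
        turn (p w) (p t) (p u) * turn (p w) (p t) (p v) > 0"
      using side[OF cV[OF vs(1)] cV[OF vs(2)] cV[OF vs(3)] cV[OF vs(4)] orth[OF e(1)] orth[OF e(2)]]
      unfolding turn_p of_int_mult[symmetric] of_int_0_less_iff by simp
  qed
qed

lemma planar_2_2: "planar (TD (residue_ring 2) 2)"
proof (rule grid_drawing_planar)
  show "grid_drawing 2 2 (\<lambda>xs. (xs ! 0, xs ! 1))" by code_simp
qed simp

text \<open>Besides the triangle on the unit vectors \<open>e\<^sub>1, e\<^sub>2, e\<^sub>3\<close>, each \<open>e\<^sub>i\<close> is joined to the sum
  of the other two, and that sum to the all-ones vector: the graph is \<open>K\<^sub>4\<close> with the three edges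
  at the all-ones vector subdivided. The all-ones vector is put at the origin and
  \<open>e\<^sub>1, e\<^sub>2, e\<^sub>3\<close> at three times \<open>(-2, -1)\<close>, \<open>(0, 2)\<close>, \<open>(1, -1)\<close>. These three pairs
  add up to almost zero, so minus the sum of two of them is close to the third, and this is a place
  for the subdividing vertex on the way from the origin. If they added up to zero, the spokes would
  be straight and the collinearity test of the drawing would fail.\<close>
lemma planar_2_3: "planar (TD (residue_ring 2) 3)"
proof (rule grid_drawing_planar)
  show "grid_drawing 2 3
      (\<lambda>xs. let k = (if sum_list xs = 1 then 3 else sum_list xs - 3)
            in (k * (xs ! 2 - 2 * xs ! 0), k * (2 * xs ! 1 - xs ! 0 - xs ! 2)))"
    by code_simp
qed simp

text \<open>The graph consists of two disjoint 4-cycles. With coordinates taken in \<open>{-1, 0, 1}\<close>, the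
  four multiples of unit vectors form a diamond, which is drawn inside the square with corners
  \<open>(\<plusminus>3, \<plusminus>3)\<close> formed by the other four vectors.\<close>
lemma planar_3_2: "planar (TD (residue_ring 3) 2)"
proof (rule grid_drawing_planar)
  show "grid_drawing 3 2
      (\<lambda>xs. let x = (xs ! 0 + 1) mod 3 - 1; y = (xs ! 1 + 1) mod 3 - 1
            in (x * (1 + 2 * y ^ 2), y * (1 + 2 * x ^ 2)))"
    by code_simp
qed simp

section \<open>The classification\<close>

theorem theorem5p2:
  fixes R :: "('a, 'b) ring_scheme" and n :: nat
  assumes "cring R" and "\<one>\<^bsub>R\<^esub> \<noteq> \<zero>\<^bsub>R\<^esub>" and "n \<ge> 2"
  shows "planar (TD R n) \<longleftrightarrow>
           graph_iso (TD R n) (TD (residue_ring 2) 2) \<or>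
           graph_iso (TD R n) (TD (residue_ring 2) 3) \<or>
           graph_iso (TD R n) (TD (residue_ring 3) 2)"
proof
  interpret cring R by fact
  interpret Z2: residues 2 "residue_ring 2" by unfold_locales auto
  interpret Z3: residues 3 "residue_ring 3" by unfold_locales auto
  assume planar: "planar (TD R n)"
  have fin: "finite (carrier R)" and "card (carrier R) \<le> 3"
    using planar_imp_few_elements[OF assms(1,3) planar] by auto
  moreover have "card (carrier R) \<ge> 2"
    using card_mono[of "carrier R" "{\<zero>\<^bsub>R\<^esub>, \<one>\<^bsub>R\<^esub>}"] fin assms(2) by simp
  ultimately consider "card (carrier R) = 2" | "card (carrier R) = 3" by linarith
  then show "graph_iso (TD R n) (TD (residue_ring 2) 2) \<or>
      graph_iso (TD R n) (TD (residue_ring 2) 3) \<or> graph_iso (TD R n) (TD (residue_ring 3) 2)"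
  proof cases
    case 1
    then obtain h where "h \<in> ring_hom R (residue_ring 2)"
        "bij_betw h (carrier R) (carrier (residue_ring 2))"
      by (rule two_element_ring_iso[OF assms(1) _ assms(2)])
    then have "graph_iso (TD R n) (TD (residue_ring 2) n)"
      by (rule graph_iso_TD[OF assms(1) Z2.cring])
    moreover have "\<not> n \<ge> 4"
      using dimension_four_not_planar[OF assms(1), of n "\<one>\<^bsub>R\<^esub>"] assms(2) planar by auto
    then have "n = 2 \<or> n = 3" using assms(3) by linarith
    ultimately show ?thesis by auto
  next
    case 2
    then obtain h where "h \<in> ring_hom R (residue_ring 3)"
        "bij_betw h (carrier R) (carrier (residue_ring 3))"
      by (rule three_element_ring_iso[OF assms(1) _ assms(2)])
    then have "graph_iso (TD R n) (TD (residue_ring 3) n)"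
      by (rule graph_iso_TD[OF assms(1) Z3.cring])
    moreover have "card (carrier R - {\<zero>\<^bsub>R\<^esub>}) = 2" using 2 fin by simp
    then obtain s t where "carrier R - {\<zero>\<^bsub>R\<^esub>} = {s, t}" "s \<noteq> t" unfolding card_2_iff by blast
    then have "\<not> n \<ge> 3" using two_nonzero_not_planar[OF assms(1), of n s t] planar by auto
    then have "n = 2" using assms(3) by linarith
    ultimately show ?thesis by auto
  qed
next
  show "planar (TD R n)" if "graph_iso (TD R n) (TD (residue_ring 2) 2) \<or>
      graph_iso (TD R n) (TD (residue_ring 2) 3) \<or> graph_iso (TD R n) (TD (residue_ring 3) 2)"
    using that planar_graph_iso[OF _ TD_simple_edges] planar_2_2 planar_2_3 planar_3_2 by blast
qed

end
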